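(* Let $p(x):=(1-x)^3(1+x)\in\mathbb{R}[x]$ and consider the problem of minimizing $1-x$ over $\{x\in\mathbb{R}: p(x)\ge 0\}=[-1,1]$, whose minimum is $f^*=0$. For $r\ge 2$ let $$e_r:=f^*-\sup\{v\in\mathbb{R} :\ 1-x-v\in\mathcal{Q}_r(p)\}$$ be its order-$r$ SOS relaxation error. Then for every integer $r\ge 2$, $$e_r=\frac{1}{2r(r-1)}.$$
   Context: $\Sigma[x]$ denotes the cone of sums of squares of univariate real polynomials. The truncated quadratic module is $$\mathcal{Q}_r(p):=\{\sigma_0+\sigma_1 p :\ \sigma_0,\sigma_1\in\Sigma[x],\ \deg\sigma_0\le 2r,\ \deg(\sigma_1 p)\le 2r\},$$ with the zero polynomial regarded as satisfying every degree bound. *)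

theory Defs
  imports
    "HOL-Computational_Algebra.Polynomial"
    "HOL-Library.Extended_Real"
begin

definition sos_polys :: "real poly set"
  where "sos_polys = {s. \<exists>qs :: real poly list. s = (\<Sum>q\<leftarrow>qs. q\<^sup>2)}"

text \<open>
  In the library \<^term>\<open>degree 0 = (0::nat)\<close>, so the zero polynomial meets every degree bound below.
\<close>

definition trunc_quadratic_module :: "nat \<Rightarrow> real poly \<Rightarrow> real poly set"
  where "trunc_quadratic_module r p =
    {s0 + s1 * p | s0 s1.
      s0 \<in> sos_polys \<and> s1 \<in> sos_polys \<and> degree s0 \<le> 2 * r \<and> degree (s1 * p) \<le> 2 * r}"

definition feasible_set :: "real poly \<Rightarrow> real set"
  where "feasible_set p = {x. poly p x \<ge> 0}"

text \<open>
  Infimum and supremum are taken in the extended reals, so that they have their usual meaning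
  also for empty or unbounded sets.
\<close>

definition opt_value :: "real poly \<Rightarrow> real poly \<Rightarrow> ereal"
  where "opt_value f p = (INF x\<in>feasible_set p. ereal (poly f x))"

definition sos_bound :: "nat \<Rightarrow> real poly \<Rightarrow> real poly \<Rightarrow> ereal"
  where "sos_bound r f p = (SUP v\<in>{v. f - [:v:] \<in> trunc_quadratic_module r p}. ereal v)"

definition sos_error :: "nat \<Rightarrow> real poly \<Rightarrow> real poly \<Rightarrow> ereal"
  where "sos_error r f p = opt_value f p - sos_bound r f p"

definition f_obj :: "real poly"
  where "f_obj = [:1, -1:]"

definition p_con :: "real poly"
  where "p_con = [:1, -1:] ^ 3 * [:1, 1:]"

end

theory Submission
  imports Defs
begin

text \<open>
  Write \<open>t = 1 - x\<close>, so that the constraint polynomial is \<open>t^3 (2 - t) = t^2 (1 - x^2)\<close>, put \<open>n = r - 1\<close>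
  and \<open>e = 1 / (2 n (n + 1))\<close>. A bound \<open>v\<close> is certified by \<open>t - v = \<sigma>0 + \<sigma>1 t^3 (2 - t)\<close>.

  \<^bold>\<open>The bound \<open>-e\<close> is attained.\<close> For \<open>z\<close> on the unit circle with real part \<open>x\<close>, a polynomial
  \<open>G(z) = z^n (B + A z)\<close> with real coefficients has \<open>|G|^2 = A^2 + B^2 + 2 A B x\<close>, while its real and
  imaginary parts are \<open>N(x)\<close> and \<open>V(x) sin \<theta>\<close> for combinations \<open>N\<close>, \<open>V\<close> of Chebyshev polynomials.
  Thus \<open>N^2 + (1 - x^2) V^2\<close> is affine in \<open>x\<close>. Requiring it to be \<open>t\<close> plus a constant, and \<open>V = t M\<close> to
  vanish at 1, determines \<open>A : B = -n : n + 1\<close> and the constant \<open>N(1)^2 = e\<close>. The result,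
  \<open>ext_decomposition\<close>, is the certificate \<open>t + e = N^2 + M^2 t^3 (2 - t)\<close>.

  \<^bold>\<open>No bound is better.\<close> Given another certificate, subtract from each square root \<open>q\<close> in \<open>\<sigma>0\<close> the
  multiple of \<open>N\<close> with the same value at 1; the remainder is divisible by \<open>t\<close>. Then
  \<open>\<sigma>0 = a N^2 + 2 t N h + t^2 S\<close> with \<open>S \<ge> 0\<close>, and the value at 1 gives \<open>v = -a e\<close>. If \<open>a < 1\<close>, eliminating
  the affine terms between the two certificates and dividing by \<open>t^2\<close> leaves
  \<open>2 N l + S' + t (2 - t) (\<sigma>1 - M^2) = 0\<close> with \<open>S' \<ge> 0\<close>, \<open>S'(1) > 0\<close> and \<open>deg l < n\<close>. At the zeros of
  \<open>t (2 - t) M\<close>, which are \<open>n + 1\<close> points of \<open>[-1, 1]\<close> including 1, this forces \<open>N l \<le> 0\<close>. By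
  \<open>alternation_nodes\<close> the signs of \<open>N\<close> alternate at these points, hence so do those of \<open>l\<close> in the weak
  sense; but a polynomial of degree below \<open>n\<close> has vanishing divided difference over \<open>n + 1\<close> points, so
  \<open>l\<close> vanishes at all of them (\<open>alternation_zero\<close>). At \<open>x = 1\<close> this contradicts \<open>S'(1) > 0\<close>. Hence
  \<open>a \<ge> 1\<close> and \<open>v \<le> -e\<close>.
\<close>

section \<open>Chebyshev polynomials\<close>

text \<open>
  These are \<open>T_n\<close> and \<open>U_{n-1}\<close>. The index shift makes them the pair with
  \<open>cos (n \<theta>) + i sin (n \<theta>) = T_n + i sin \<theta> S_n\<close> at \<open>x = cos \<theta>\<close>, and the joint recursion is the
  multiplication of this number by \<open>cos \<theta> + i sin \<theta>\<close>.
\<close>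
fun cheb_T :: "nat \<Rightarrow> real poly" and cheb_S :: "nat \<Rightarrow> real poly"
  where
    "cheb_T 0 = 1"
  | "cheb_S 0 = 0"
  | "cheb_T (Suc n) = [:0, 1:] * cheb_T n - [:1, 0, -1:] * cheb_S n"
  | "cheb_S (Suc n) = [:0, 1:] * cheb_S n + cheb_T n"

lemma poly_cheb_cos:
  "poly (cheb_T n) (cos \<theta>) = cos (real n * \<theta>)"
  "poly (cheb_S n) (cos \<theta>) * sin \<theta> = sin (real n * \<theta>)"
proof (induction n)
  case (Suc n)
  have arg: "real (Suc n) * \<theta> = \<theta> + real n * \<theta>"
    by (simp add: algebra_simps)
  have s2: "1 - cos \<theta> * cos \<theta> = sin \<theta> * sin \<theta>"
    using sin_cos_squared_add[of \<theta>] by (simp add: power2_eq_square algebra_simps)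
  {
    case 1
    have "poly (cheb_T (Suc n)) (cos \<theta>)
        = cos \<theta> * poly (cheb_T n) (cos \<theta>) - (1 - cos \<theta> * cos \<theta>) * poly (cheb_S n) (cos \<theta>)"
      by (simp add: algebra_simps)
    also have "\<dots> = cos \<theta> * poly (cheb_T n) (cos \<theta>) - sin \<theta> * (poly (cheb_S n) (cos \<theta>) * sin \<theta>)"
      by (simp only: s2) (simp add: algebra_simps)
    also have "\<dots> = cos (real (Suc n) * \<theta>)"
      by (simp only: Suc arg cos_add)
    finally show ?case .
  next
    case 2
    have "poly (cheb_S (Suc n)) (cos \<theta>) * sin \<theta>
        = cos \<theta> * (poly (cheb_S n) (cos \<theta>) * sin \<theta>) + poly (cheb_T n) (cos \<theta>) * sin \<theta>"
      by (simp add: algebra_simps)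
    also have "\<dots> = sin (real (Suc n) * \<theta>)"
      by (simp only: Suc arg sin_add) simp
    finally show ?case .
  }
qed auto

lemma poly_cheb_1: "poly (cheb_T n) 1 = 1" "poly (cheb_S n) 1 = real n"
  by (induction n) auto

lemma degree_cheb: "degree (cheb_T n) \<le> n" "degree (cheb_S n) \<le> n - 1"
proof (induction n)
  case (Suc n)
  have X: "degree ([:0, 1:] * q :: real poly) \<le> 1 + degree q" for q
    by (rule order.trans[OF degree_mult_le]) simp
  have Y: "degree ([:1, 0, -1:] * q :: real poly) \<le> 2 + degree q" for q
    by (rule order.trans[OF degree_mult_le]) simp
  {
    case 1
    show ?case
    proof (cases n)
      case (Suc m)
      have "degree ([:1, 0, -1:] * cheb_S n) \<le> Suc n"
        using Y[of "cheb_S n"] Suc.IH(2) Suc by simp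
      moreover have "degree ([:0, 1:] * cheb_T n) \<le> Suc n"
        using X[of "cheb_T n"] Suc.IH(1) by simp
      ultimately show ?thesis
        by (simp only: cheb_T.simps degree_diff_le)
    qed simp
  next
    case 2
    show ?case
    proof (cases n)
      case (Suc m)
      have "degree ([:0, 1:] * cheb_S n) \<le> n"
        using X[of "cheb_S n"] Suc.IH(2) Suc by simp
      then show ?thesis
        using Suc.IH(1) by (simp only: cheb_S.simps degree_add_le diff_Suc_1)
    qed simp
  }
qed auto

text \<open>
  Multiplication by \<open>cos \<theta> + i sin \<theta>\<close> preserves the modulus, and the recursion makes this a polynomial
  identity. The mixed identity after it is the inner product of two successive powers, whose
  angle is \<open>\<theta>\<close>.
\<close>
lemma cheb_pell: "(cheb_T n)\<^sup>2 + [:1, 0, -1:] * (cheb_S n)\<^sup>2 = 1"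
proof (induction n)
  case (Suc n)
  have w: "[:1, 0, -1:] = 1 - [:0, 1 :: real:]\<^sup>2"
    by (simp add: power2_eq_square one_pCons)
  have "([:0, 1:] * cheb_T n - (1 - [:0, 1:]\<^sup>2) * cheb_S n)\<^sup>2
      + (1 - [:0, 1:]\<^sup>2) * ([:0, 1:] * cheb_S n + cheb_T n)\<^sup>2
      = (cheb_T n)\<^sup>2 + (1 - [:0, 1:]\<^sup>2) * (cheb_S n)\<^sup>2"
    by algebra
  with Suc show ?case
    by (simp only: cheb_T.simps cheb_S.simps w)
qed simp

lemma cheb_pell_mixed:
  "cheb_T n * cheb_T (Suc n) + [:1, 0, -1:] * (cheb_S n * cheb_S (Suc n)) = [:0, 1:]"
proof -
  have "cheb_T n * ([:0, 1:] * cheb_T n - w * cheb_S n)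
      + w * (cheb_S n * ([:0, 1:] * cheb_S n + cheb_T n))
      = [:0, 1:] * ((cheb_T n)\<^sup>2 + w * (cheb_S n)\<^sup>2)" for w
    by algebra
  then show ?thesis
    by (simp only: cheb_T.simps cheb_S.simps cheb_pell mult_1_right)
qed

section \<open>The extremal decomposition\<close>

text \<open>
  For \<open>G(z) = c (n + 1) z^n - c n z^(n+1)\<close> the coefficient of \<open>x\<close> in \<open>|G|^2\<close> is \<open>-2 n (n + 1) c^2\<close>. This number
  \<open>c\<close> makes it \<open>-1\<close>. Its square turns out to be the relaxation error of order \<open>n + 1\<close>.
\<close>
definition err_root :: "nat \<Rightarrow> real"
  where "err_root n = 1 / sqrt (2 * real n * (real n + 1))"

text \<open>
  The real part of \<open>G(z)\<close>, and its imaginary part divided by \<open>sin \<theta>\<close>, as polynomials in \<open>x = cos \<theta>\<close>.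
\<close>

definition ext_N :: "nat \<Rightarrow> real poly"
  where "ext_N n = smult (err_root n)
    (smult (real n + 1) (cheb_T n) - smult (real n) (cheb_T (Suc n)))"

definition ext_V :: "nat \<Rightarrow> real poly"
  where "ext_V n = smult (err_root n)
    (smult (real n + 1) (cheb_S n) - smult (real n) (cheb_S (Suc n)))"

definition ext_M :: "nat \<Rightarrow> real poly"
  where "ext_M n = ext_V n div [:1, -1:]"

lemma err_root_pos: "n \<ge> 1 \<Longrightarrow> err_root n > 0"
  by (simp add: err_root_def)

lemma err_root_sq: "(err_root n)\<^sup>2 = 1 / (2 * real n * (real n + 1))"
  by (simp add: err_root_def power_divide)

lemma root_1_factor:
  fixes q :: "real poly"
  assumes "poly q 1 = 0"
  obtains h where "q = [:1, -1:] * h"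
proof -
  have "[:-1, 1:] dvd q"
    using assms poly_eq_0_iff_dvd[of q 1] by simp
  then obtain h where "q = [:-1, 1:] * h"
    by (elim dvdE)
  then have "q = [:1, -1:] * (- h)"
    by simp
  then show thesis
    by (rule that)
qed

text \<open>
  The coefficients \<open>n + 1\<close> and \<open>-n\<close> are chosen for this: \<^term>\<open>cheb_S n\<close> takes the value \<open>n\<close> at 1, so
  the combination vanishes there, which supplies two of the three factors \<open>1 - x\<close> of the constraint
  polynomial after squaring; the third
  comes from \<open>1 - x^2\<close>.
\<close>

lemma ext_V_eq: "ext_V n = [:1, -1:] * ext_M n"
proof -
  have "poly (ext_V n) 1 = 0"
    unfolding ext_V_def
    by (simp only: poly_smult poly_diff poly_cheb_1) simp
  then obtain h where h: "ext_V n = [:1, -1:] * h"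
    by (rule root_1_factor)
  have "ext_M n = h"
    unfolding ext_M_def h by (rule nonzero_mult_div_cancel_left) simp
  with h show ?thesis
    by simp
qed

lemma degree_ext_N: "degree (ext_N n) \<le> Suc n"
  unfolding ext_N_def
  by (intro order.trans[OF degree_smult_le] degree_diff_le degree_cheb(1)
      order.trans[OF degree_cheb(1)]) auto

lemma degree_ext_V: "degree (ext_V n) \<le> n"
proof -
  have "degree (cheb_S n) \<le> n" "degree (cheb_S (Suc n)) \<le> n"
    using degree_cheb(2)[of n] degree_cheb(2)[of "Suc n"] by simp_all
  then show ?thesis
    unfolding ext_V_def
    by (intro order.trans[OF degree_smult_le] degree_diff_le)
qed

text \<open>
  An inequality with truncated subtraction, since for \<open>q = 0\<close> the product has degree 0 as well.
\<close>
lemma degree_cofactor: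
  fixes q :: "real poly"
  shows "degree q \<le> degree ([:1, -1:] * q) - 1"
proof (cases "q = 0")
  case False
  then show ?thesis
    by (subst degree_mult_eq) auto
qed simp

lemma degree_ext_M: "degree (ext_M n) \<le> n - 1"
  using degree_cofactor[of "ext_M n"] degree_ext_V[of n] ext_V_eq[of n] by simp

lemma poly_ext_N_1: "poly (ext_N n) 1 = err_root n"
  unfolding ext_N_def
  by (simp only: poly_smult poly_diff poly_cheb_1) simp

text \<open>
  With \<open>P\<close>, \<open>Q\<close> the absolute values of the two coefficients, the left side is
  \<open>P^2 + Q^2 - 2 P Q x = (P - Q)^2 + 2 P Q (1 - x)\<close>, where \<open>P - Q = c\<close> and \<open>2 P Q = 1\<close>.
\<close>
lemma ext_pell:
  assumes "n \<ge> 1"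
  shows "(ext_N n)\<^sup>2 + [:1, 0, -1:] * (ext_V n)\<^sup>2 = [:1, -1:] + [:(err_root n)\<^sup>2:]"
proof -
  let ?w = "[:1, 0, -1:] :: real poly" and ?X = "[:0, 1:] :: real poly"
  define P Q where "P = [:err_root n * (real n + 1):]" and "Q = [:err_root n * real n:]"
  have N: "ext_N n = P * cheb_T n - Q * cheb_T (Suc n)"
    and V: "ext_V n = P * cheb_S n - Q * cheb_S (Suc n)"
    unfolding ext_N_def ext_V_def P_def Q_def
    by (simp_all add: smult_diff_right del: cheb_T.simps cheb_S.simps)
  have "(ext_N n)\<^sup>2 + ?w * (ext_V n)\<^sup>2
      = P\<^sup>2 * ((cheb_T n)\<^sup>2 + ?w * (cheb_S n)\<^sup>2)
      + Q\<^sup>2 * ((cheb_T (Suc n))\<^sup>2 + ?w * (cheb_S (Suc n))\<^sup>2)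
      - 2 * P * Q * (cheb_T n * cheb_T (Suc n) + ?w * (cheb_S n * cheb_S (Suc n)))"
    unfolding N V by algebra
  also have "\<dots> = P\<^sup>2 + Q\<^sup>2 - 2 * P * Q * ?X"
    by (simp only: cheb_pell cheb_pell_mixed mult_1_right)
  also have "\<dots> = (P - Q)\<^sup>2 + 2 * P * Q * (1 - ?X)"
    by algebra
  also have "P - Q = [:err_root n:]"
    by (simp add: P_def Q_def algebra_simps)
  also have "2 * P * Q = [:2 * real n * (real n + 1) * (err_root n)\<^sup>2:]"
    by (simp add: P_def Q_def numeral_poly power2_eq_square algebra_simps)
  also have "\<dots> = 1"
    using assms by (simp add: err_root_sq one_pCons)
  finally show ?thesis
    by (simp add: power2_eq_square one_pCons)
qed

lemma p_con_altdef: "p_con = [:1, -1:]\<^sup>2 * [:1, 0, -1:]"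
  by (simp add: p_con_def power2_eq_square power3_eq_cube)

lemma ext_decomposition:
  assumes "n \<ge> 1"
  shows "f_obj + [:(err_root n)\<^sup>2:] = (ext_N n)\<^sup>2 + (ext_M n)\<^sup>2 * p_con"
  using ext_pell[OF assms]
  by (simp only: ext_V_eq p_con_altdef f_obj_def power_mult_distrib mult_ac)

lemma square_sos: "q\<^sup>2 \<in> sos_polys"
  unfolding sos_polys_def by (auto intro!: exI[of _ "[q]"])

lemma ext_feasible:
  assumes "n \<ge> 1"
  shows "f_obj - [:- (err_root n)\<^sup>2:] \<in> trunc_quadratic_module (Suc n) p_con"
proof -
  have "degree ((ext_N n)\<^sup>2) \<le> 2 * Suc n"
    by (rule order.trans[OF degree_power_le]) (use degree_ext_N[of n] in simp)
  moreover have "degree ((ext_M n)\<^sup>2 * p_con) \<le> 2 * Suc n"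
  proof -
    have "degree ((ext_M n)\<^sup>2) \<le> 2 * (n - 1)"
      by (rule order.trans[OF degree_power_le]) (use degree_ext_M[of n] in simp)
    moreover have "degree p_con \<le> 4"
      by (simp add: p_con_def power3_eq_cube)
    ultimately show ?thesis
      using assms by (intro order.trans[OF degree_mult_le]) simp
  qed
  moreover have "f_obj - [:- (err_root n)\<^sup>2:] = (ext_N n)\<^sup>2 + (ext_M n)\<^sup>2 * p_con"
    using ext_decomposition[OF assms] by (simp add: f_obj_def)
  ultimately show ?thesis
    unfolding trunc_quadratic_module_def using square_sos by blast
qed

section \<open>The alternation nodes\<close>

lemma cos_near_multiple_pi:
  assumes "real k * pi - pi / 2 < a" "a < real k * pi + pi / 2"
  shows "(-1) ^ k * cos a > 0"
proof -
  have "cos (a - real k * pi) > 0"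
    using assms by (intro cos_gt_zero_pi) auto
  then show ?thesis
    by (simp add: cos_diff mult.commute)
qed

text \<open>
  At an angle where the imaginary part of \<open>(n + 1) z^n - n z^(n+1)\<close> vanishes, the two summands have
  imaginary parts of equal size; as the first has the larger modulus, it also has the larger
  real part in absolute value and decides the sign of the sum.
\<close>
lemma alternation_sign:
  fixes n k :: nat and \<theta> :: real
  assumes n: "n \<ge> 1"
    and eq: "(real n + 1) * sin (real n * \<theta>) = real n * sin (real (Suc n) * \<theta>)"
    and pos: "(-1) ^ k * cos (real n * \<theta>) > 0"
  shows "(-1) ^ k * ((real n + 1) * cos (real n * \<theta>) - real n * cos (real (Suc n) * \<theta>)) > 0"
proof -
  define a b where "a = real n * \<theta>" and "b = real (Suc n) * \<theta>"
  have "(real n * cos b)\<^sup>2 = (real n)\<^sup>2 - (real n * sin b)\<^sup>2"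
    using sin_cos_squared_add[of b] by algebra
  also have "\<dots> = (real n)\<^sup>2 - ((real n + 1) * sin a)\<^sup>2"
    using eq by (simp add: a_def b_def)
  also have "\<dots> < (real n + 1)\<^sup>2 - ((real n + 1) * sin a)\<^sup>2"
    by (simp add: power_strict_mono)
  also have "\<dots> = ((real n + 1) * cos a)\<^sup>2"
    using sin_cos_squared_add[of a] by algebra
  finally have "\<bar>real n * cos b\<bar> < \<bar>(real n + 1) * cos a\<bar>"
    using abs_le_square_iff[of "(real n + 1) * cos a" "real n * cos b"] by linarith
  also have "\<dots> = (real n + 1) * ((-1) ^ k * cos a)"
    using pos by (cases "even k") (auto simp: a_def abs_mult)
  finally have "(-1) ^ k * (real n * cos b) < (real n + 1) * ((-1) ^ k * cos a)"
    by (cases "even k") auto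
  then show ?thesis
    by (simp add: a_def b_def algebra_simps)
qed

text \<open>
  Halfway between consecutive multiples of \<open>\<pi> / n\<close> the sine of \<open>n \<theta>\<close> is \<open>1\<close> or \<open>-1\<close> in turn, and the factor
  \<open>n + 1\<close> beats \<open>n\<close>; so the difference of the two sides changes sign between neighbouring midpoints,
  and each multiple \<open>k \<pi> / n\<close> with \<open>0 < k < n\<close> has a zero in its own midpoint interval. The end points
  \<open>0\<close> and \<open>\<pi>\<close> are zeros themselves.
\<close>
lemma alternation_angle:
  fixes n k :: nat
  assumes n: "n \<ge> 1" and k: "k \<le> n"
  obtains \<theta> where "0 \<le> \<theta>" "\<theta> \<le> pi" "k = 0 \<Longrightarrow> \<theta> = 0"
    "real k * pi - pi / 2 < real n * \<theta>" "real n * \<theta> < real k * pi + pi / 2"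
    "(real n + 1) * sin (real n * \<theta>) = real n * sin (real (Suc n) * \<theta>)"
proof -
  define F where "F \<theta> = (real n + 1) * sin (real n * \<theta>) - real n * sin (real (Suc n) * \<theta>)" for \<theta>
  have F_eq: "(real n + 1) * sin (real n * \<theta>) = real n * sin (real (Suc n) * \<theta>) \<longleftrightarrow> F \<theta> = 0" for \<theta>
    by (simp add: F_def)
  define \<phi> where "\<phi> j = (real j + 1 / 2) * pi / real n" for j
  have n_phi: "real n * \<phi> j = real j * pi + pi / 2" for j
    using n by (simp add: \<phi>_def field_simps)
  have sign: "(-1) ^ j * F (\<phi> j) > 0" for j
  proof -
    have "sin (real n * \<phi> j) = (-1) ^ j"
      unfolding n_phi by (simp add: sin_add)
    then have "(-1) ^ j * F (\<phi> j) = (real n + 1) - real n * ((-1) ^ j * sin (real (Suc n) * \<phi> j))"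
      unfolding F_def by (cases "even j") (auto simp: algebra_simps)
    moreover have "(-1) ^ j * sin (real (Suc n) * \<phi> j) \<le> 1"
      using sin_le_one[of "real (Suc n) * \<phi> j"] sin_ge_minus_one[of "real (Suc n) * \<phi> j"]
      by (cases "even j") (simp_all del: sin_le_one sin_ge_minus_one)
    then have "real n * ((-1) ^ j * sin (real (Suc n) * \<phi> j)) \<le> real n * 1"
      by (intro mult_left_mono) auto
    ultimately show ?thesis
      by linarith
  qed
  consider "k = 0" | "k = n" | "0 < k" "k < n"
    using k by linarith
  then show ?thesis
  proof cases
    case 1
    then show ?thesis
      by (intro that[of 0]) auto
  next
    case 2
    then show ?thesis
      using n sin_npi[of n] sin_npi[of "Suc n"] by (intro that[of pi]) auto
  next
    case 3
    obtain j where j: "k = Suc j"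
      using 3 by (cases k) auto
    have le: "\<phi> j \<le> \<phi> k"
      unfolding \<phi>_def j by (intro divide_right_mono mult_right_mono) auto
    have cont: "continuous_on {\<phi> j..\<phi> k} F"
      unfolding F_def by (intro continuous_intros)
    have "\<exists>\<theta>. \<phi> j \<le> \<theta> \<and> \<theta> \<le> \<phi> k \<and> F \<theta> = 0"
    proof (cases "even j")
      case True
      then have "F (\<phi> k) \<le> 0" "0 \<le> F (\<phi> j)"
        using sign[of j] sign[of k] by (auto simp: j)
      then show ?thesis
        using IVT2'[OF _ _ le cont] by blast
    next
      case False
      then have "F (\<phi> j) \<le> 0" "0 \<le> F (\<phi> k)"
        using sign[of j] sign[of k] by (auto simp: j)
      then show ?thesis
        using IVT'[OF _ _ le cont] by blast
    qed
    then obtain \<theta> where \<theta>: "\<phi> j \<le> \<theta>" "\<theta> \<le> \<phi> k" "F \<theta> = 0"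
      by blast
    have "\<theta> \<noteq> \<phi> j" "\<theta> \<noteq> \<phi> k"
      using sign[of j] sign[of k] \<theta>(3) by auto
    then have lt: "\<phi> j < \<theta>" "\<theta> < \<phi> k"
      using \<theta> by auto
    then have nt: "real n * \<phi> j < real n * \<theta>" "real n * \<theta> < real n * \<phi> k"
      using n by auto
    have "0 \<le> \<phi> j"
      by (simp add: \<phi>_def)
    moreover have "real n * \<phi> k \<le> real n * pi"
    proof -
      have "real k + 1 / 2 \<le> real n"
        using 3 by linarith
      then have "(real k + 1 / 2) * pi \<le> real n * pi"
        by (intro mult_right_mono) auto
      then show ?thesis
        by (simp add: n_phi algebra_simps)
    qed
    then have "real n * \<theta> < real n * pi"
      using nt(2) by linarith
    then have "\<theta> < pi"
      using n by simp
    moreover have "real k * pi - pi / 2 < real n * \<theta>"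
      using nt(1) unfolding n_phi j by (simp add: algebra_simps)
    moreover have "real n * \<theta> < real k * pi + pi / 2"
      using nt(2) unfolding n_phi .
    ultimately show ?thesis
      using lt \<theta>(3) 3 F_eq[of \<theta>] by (intro that[of \<theta>]) linarith+
  qed
qed

text \<open>
  The cosines of the angles above. They are the zeros of \<open>(1 - x^2) M\<close>: at an interior angle the sine
  and \<open>1 - x\<close> are nonzero, so the vanishing imaginary part can only come from \<open>M\<close>.
\<close>
lemma alternation_nodes:
  assumes n: "n \<ge> 1"
  obtains x :: "nat \<Rightarrow> real"
  where "x 0 = 1" "\<And>i j. i < j \<Longrightarrow> j \<le> n \<Longrightarrow> x j < x i"
    "\<And>k. k \<le> n \<Longrightarrow> (x k)\<^sup>2 \<le> 1"
    "\<And>k. k \<le> n \<Longrightarrow> (-1) ^ k * poly (ext_N n) (x k) > 0"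
    "\<And>k. k \<le> n \<Longrightarrow> (1 - (x k)\<^sup>2) * (poly (ext_M n) (x k))\<^sup>2 = 0"
proof -
  have "\<exists>\<theta>. 0 \<le> \<theta> \<and> \<theta> \<le> pi \<and> (k = 0 \<longrightarrow> \<theta> = 0) \<and>
    real k * pi - pi / 2 < real n * \<theta> \<and> real n * \<theta> < real k * pi + pi / 2 \<and>
    (real n + 1) * sin (real n * \<theta>) = real n * sin (real (Suc n) * \<theta>)" if "k \<le> n" for k
    by (rule alternation_angle[OF n that]) blast
  then obtain \<theta> where \<theta>: "\<And>k. k \<le> n \<Longrightarrow> 0 \<le> \<theta> k \<and> \<theta> k \<le> pi \<and> (k = 0 \<longrightarrow> \<theta> k = 0) \<and>
    real k * pi - pi / 2 < real n * \<theta> k \<and> real n * \<theta> k < real k * pi + pi / 2 \<and>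
    (real n + 1) * sin (real n * \<theta> k) = real n * sin (real (Suc n) * \<theta> k)"
    by metis
  show ?thesis
  proof (rule that[of "\<lambda>k. cos (\<theta> k)"])
    show "cos (\<theta> 0) = 1"
      using \<theta>[of 0] by simp
    show "cos (\<theta> j) < cos (\<theta> i)" if "i < j" "j \<le> n" for i j
    proof -
      have "(real i + 1) * pi \<le> real j * pi"
        using that by (intro mult_right_mono) auto
      then have "real n * \<theta> i < real n * \<theta> j"
        using \<theta>[of i] \<theta>[of j] that unfolding distrib_right by linarith
      then have "\<theta> i < \<theta> j"
        using n by simp
      then show ?thesis
        using \<theta>[of i] \<theta>[of j] that by (intro cos_monotone_0_pi) auto
    qed
    fix k assume k: "k \<le> n"
    show "(cos (\<theta> k))\<^sup>2 \<le> 1"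
      using sin_cos_squared_add[of "\<theta> k"] zero_le_power2[of "sin (\<theta> k)"] by linarith
    have "(-1) ^ k * cos (real n * \<theta> k) > 0"
      using \<theta>[OF k] by (intro cos_near_multiple_pi) auto
    then have "(-1) ^ k * ((real n + 1) * cos (real n * \<theta> k) - real n * cos (real (Suc n) * \<theta> k)) > 0"
      using \<theta>[OF k] n by (intro alternation_sign) auto
    then have "err_root n * ((-1) ^ k *
        ((real n + 1) * cos (real n * \<theta> k) - real n * cos (real (Suc n) * \<theta> k))) > 0"
      using err_root_pos[OF n] by simp
    then show "(-1) ^ k * poly (ext_N n) (cos (\<theta> k)) > 0"
      unfolding ext_N_def
      by (simp only: poly_smult poly_diff poly_cheb_cos mult_ac)
    have "poly (ext_V n) (cos (\<theta> k)) * sin (\<theta> k) = err_root n *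
      ((real n + 1) * (poly (cheb_S n) (cos (\<theta> k)) * sin (\<theta> k))
        - real n * (poly (cheb_S (Suc n)) (cos (\<theta> k)) * sin (\<theta> k)))"
      unfolding ext_V_def by (simp only: poly_smult poly_diff) (simp add: algebra_simps)
    also have "\<dots> = 0"
      using \<theta>[OF k] by (simp only: poly_cheb_cos) simp
    finally have "(1 - cos (\<theta> k)) * (sin (\<theta> k) * poly (ext_M n) (cos (\<theta> k))) = 0"
      by (simp add: ext_V_eq algebra_simps)
    then have "sin (\<theta> k) * poly (ext_M n) (cos (\<theta> k)) = 0"
      using sin_squared_eq[of "\<theta> k"] by auto
    then have "(sin (\<theta> k))\<^sup>2 * (poly (ext_M n) (cos (\<theta> k)))\<^sup>2 = 0"
      by auto
    then show "(1 - (cos (\<theta> k))\<^sup>2) * (poly (ext_M n) (cos (\<theta> k)))\<^sup>2 = 0"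
      by (simp only: sin_squared_eq)
  qed
qed

section \<open>Divided differences and weak alternation\<close>

text \<open>
  Lagrange interpolation at \<open>n + 1\<close> nodes reproduces \<open>f\<close>, and the sum is the coefficient of degree \<open>n\<close> of
  the interpolant.
\<close>
lemma divided_difference_eq_0:
  fixes f :: "real poly" and x :: "nat \<Rightarrow> real"
  assumes inj: "inj_on x {..n}" and deg: "degree f < n"
  shows "(\<Sum>j\<le>n. poly f (x j) / (\<Prod>i\<in>{..n} - {j}. x j - x i)) = 0"
proof -
  define W where "W j = (\<Prod>i\<in>{..n} - {j}. x j - x i)" for j
  define L where "L j = (\<Prod>i\<in>{..n} - {j}. [:- x i, 1:])" for j
  define g where "g = (\<Sum>j\<le>n. smult (poly f (x j) / W j) (L j)) - f"
  have W: "W j \<noteq> 0" if "j \<le> n" for j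
    using that inj by (auto simp: W_def inj_on_def)
  have L_diag: "poly (L j) (x j) = W j" for j
    by (simp add: L_def W_def poly_prod)
  have L_off: "poly (L j) (x k) = 0" if "k \<le> n" "k \<noteq> j" for j k
    using that by (auto simp: L_def poly_prod intro!: bexI[of _ k])
  have L_monic: "degree (L j) = n \<and> coeff (L j) n = 1" if "j \<le> n" for j
  proof -
    have "degree (L j) = n"
      unfolding L_def using that by (subst degree_prod_eq_sum_degree) auto
    moreover have "lead_coeff (L j) = 1"
      unfolding L_def by (simp add: lead_coeff_prod)
    ultimately show ?thesis by simp
  qed
  have root: "poly g (x k) = 0" if "k \<le> n" for k
  proof -
    have "(\<Sum>j\<le>n. poly f (x j) / W j * poly (L j) (x k)) = (\<Sum>j\<le>n. if j = k then poly f (x k) else 0)"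
      using W L_diag L_off that by (intro sum.cong) auto
    also have "\<dots> = poly f (x k)"
      using that by simp
    finally show ?thesis
      by (simp add: g_def poly_sum)
  qed
  have deg_g: "degree g \<le> n"
    unfolding g_def using deg L_monic
    by (intro degree_diff_le degree_sum_le order.trans[OF degree_smult_le]) auto
  have "g = 0"
  proof (rule ccontr)
    assume "g \<noteq> 0"
    have "Suc n = card (x ` {..n})"
      using card_image[OF inj] by simp
    also have "\<dots> \<le> card {y. poly g y = 0}"
      using root poly_roots_finite[OF \<open>g \<noteq> 0\<close>] by (intro card_mono) auto
    also have "\<dots> \<le> degree g"
      by (rule card_poly_roots_bound[OF \<open>g \<noteq> 0\<close>])
    finally show False
      using deg_g by simp
  qed
  then have "0 = coeff g n"
    by simp
  also have "\<dots> = (\<Sum>j\<le>n. poly f (x j) / W j)"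
    using L_monic deg by (simp add: g_def coeff_sum coeff_eq_0)
  finally show ?thesis
    by (simp add: W_def)
qed

lemma node_product_sign:
  fixes x :: "nat \<Rightarrow> real"
  assumes dec: "\<And>i j. i < j \<Longrightarrow> j \<le> n \<Longrightarrow> x j < x i" and "j \<le> n"
  shows "(-1) ^ j * (\<Prod>i\<in>{..n} - {j}. x j - x i) > 0"
proof -
  have nodes: "{..n} - {j} = {..<j} \<union> {j<..n}"
    using assms(2) by auto
  have flip: "(\<Prod>i<j. x j - x i) = (-1) ^ j * (\<Prod>i<j. x i - x j)"
    using prod_uminus[of "\<lambda>i. x i - x j" "{..<j}"] by (simp only: minus_diff_eq card_lessThan)
  have "(\<Prod>i\<in>{..n} - {j}. x j - x i) = (\<Prod>i<j. x j - x i) * (\<Prod>i\<in>{j<..n}. x j - x i)"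
    unfolding nodes by (rule prod.union_disjoint) auto
  then have "(-1) ^ j * (\<Prod>i\<in>{..n} - {j}. x j - x i)
      = (\<Prod>i<j. x i - x j) * (\<Prod>i\<in>{j<..n}. x j - x i)"
    unfolding flip by (cases "even j") simp_all
  moreover have "(\<Prod>i<j. x i - x j) > 0" "(\<Prod>i\<in>{j<..n}. x j - x i) > 0"
    using assms by (auto intro!: prod_pos)
  ultimately show ?thesis
    by simp
qed

text \<open>
  For decreasing nodes the denominators of the divided difference alternate in sign too, so its
  terms all have the same sign; as they add up to 0, each of them is 0.
\<close>
lemma alternation_zero:
  fixes l :: "real poly" and x :: "nat \<Rightarrow> real"
  assumes dec: "\<And>i j. i < j \<Longrightarrow> j \<le> n \<Longrightarrow> x j < x i"
    and deg: "degree l < n"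
    and alt: "\<And>k. k \<le> n \<Longrightarrow> (-1) ^ k * poly l (x k) \<le> 0"
    and k: "k \<le> n"
  shows "poly l (x k) = 0"
proof -
  define W where "W j = (\<Prod>i\<in>{..n} - {j}. x j - x i)" for j
  have W: "(-1) ^ j * W j > 0" if "j \<le> n" for j
    unfolding W_def using dec that by (rule node_product_sign)
  have inj: "inj_on x {..n}"
  proof (rule linorder_inj_onI')
    fix i j assume "i \<in> {..n}" "j \<in> {..n}" "i < j"
    then show "x i \<noteq> x j"
      using dec[of i j] by auto
  qed
  have term_nonpos: "poly l (x j) / W j \<le> 0" if "j \<le> n" for j
  proof -
    have "poly l (x j) / W j = ((-1) ^ j * poly l (x j)) / ((-1) ^ j * W j)"
      by simp
    also have "\<dots> \<le> 0"
      using alt[OF that] W[OF that] by (rule divide_nonpos_pos)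
    finally show ?thesis .
  qed
  have "(\<Sum>j\<le>n. poly l (x j) / W j) = 0"
    unfolding W_def by (rule divided_difference_eq_0[OF inj deg])
  then have "poly l (x k) / W k = 0"
    using sum_nonneg_eq_0_iff[of "{..n}" "\<lambda>j. - (poly l (x j) / W j)"] term_nonpos k
    by (simp add: sum_negf)
  then show ?thesis
    using W[OF k] by auto
qed

section \<open>Optimality of the bound\<close>

text \<open>
  Over the reals the leading terms of squares cannot cancel: at twice the largest degree \<open>m\<close> the
  coefficient of the sum is a sum of squares of numbers, not all of them 0.
\<close>
lemma sos_degree_bound:
  fixes qs :: "real poly list"
  assumes "degree (\<Sum>q\<leftarrow>qs. q\<^sup>2) \<le> 2 * r" and "q \<in> set qs"
  shows "degree q \<le> r"
proof (rule ccontr)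
  assume "\<not> degree q \<le> r"
  define m where "m = Max (degree ` set qs)"
  have le: "degree p \<le> m" if "p \<in> set qs" for p
    unfolding m_def using that by (intro Max_ge) auto
  have m: "m > r"
    using le[OF assms(2)] \<open>\<not> degree q \<le> r\<close> by simp
  have "qs \<noteq> []"
    using assms(2) by auto
  then have "m \<in> degree ` set qs"
    unfolding m_def by (intro Max_in) auto
  then obtain p where p: "p \<in> set qs" "degree p = m"
    by auto
  have sq: "coeff (u\<^sup>2) (2 * m) = (coeff u m)\<^sup>2" if "degree u \<le> m" for u :: "real poly"
  proof (cases "degree u = m")
    case True
    then show ?thesis
      using coeff_mult_degree_sum[of u u] by (simp add: power2_eq_square mult_2)
  next
    case False
    then have "degree (u\<^sup>2) < 2 * m" "degree u < m"
      using that degree_power_le[of u 2] by auto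
    then show ?thesis
      by (simp add: coeff_eq_0)
  qed
  have "coeff (\<Sum>q\<leftarrow>qs'. q\<^sup>2) (2 * m) = (\<Sum>q\<leftarrow>qs'. (coeff q m)\<^sup>2)" if "set qs' \<subseteq> set qs" for qs'
    using that by (induction qs') (auto simp: sq le)
  from this[of qs] have "(\<Sum>q\<leftarrow>qs. (coeff q m)\<^sup>2) = 0"
    using m assms(1) by (simp add: coeff_eq_0)
  then have "(coeff p m)\<^sup>2 = 0"
    using p by (subst (asm) sum_list_nonneg_eq_0_iff) auto
  then have "p = 0"
    using p by auto
  then show False
    using p m by simp
qed

text \<open>
  Each \<open>q\<close> is \<open>b N + (1 - x) g\<close> with \<open>b = q(1) / N(1)\<close>; then \<open>a\<close> is the sum of the \<open>b^2\<close>, \<open>h\<close> the sum of the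
  \<open>b g\<close> and \<open>S\<close> the sum of the \<open>g^2\<close>. This isolates what the certificate has in common with the extremal
  one, and the degree bound of \<open>h\<close> is one less than that of \<open>N\<close>.
\<close>
lemma sos_split:
  fixes N :: "real poly" and qs :: "real poly list"
  assumes N: "poly N 1 \<noteq> 0" "degree N \<le> Suc n"
    and deg: "\<And>q. q \<in> set qs \<Longrightarrow> degree q \<le> Suc n"
  obtains a h S where
    "(\<Sum>q\<leftarrow>qs. q\<^sup>2) = [:a:] * N\<^sup>2 + 2 * [:1, -1:] * N * h + [:1, -1:]\<^sup>2 * S"
    "degree h \<le> n" "\<And>x. poly S x \<ge> 0"
proof -
  have "\<exists>a h S. (\<Sum>q\<leftarrow>qs. q\<^sup>2) = [:a:] * N\<^sup>2 + 2 * [:1, -1:] * N * h + [:1, -1:]\<^sup>2 * S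
      \<and> degree h \<le> n \<and> (\<forall>x. poly S x \<ge> 0)"
    using deg
  proof (induction qs)
    case Nil
    show ?case
      by (intro exI[of _ 0]) auto
  next
    case (Cons q qs)
    obtain a h S where IH:
      "(\<Sum>q\<leftarrow>qs. q\<^sup>2) = [:a:] * N\<^sup>2 + 2 * [:1, -1:] * N * h + [:1, -1:]\<^sup>2 * S"
      "degree h \<le> n" "\<And>x. poly S x \<ge> 0"
      using Cons by auto
    define b where "b = poly q 1 / poly N 1"
    have "poly (q - [:b:] * N) 1 = 0"
      using N by (simp add: b_def)
    then obtain g where g: "q - [:b:] * N = [:1, -1:] * g"
      by (rule root_1_factor)
    have "degree (q - [:b:] * N) \<le> Suc n"
      using Cons.prems N by (intro degree_diff_le) auto
    then have deg_g: "degree g \<le> n"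
      using degree_cofactor[of g] unfolding g by linarith
    have q: "q = [:b:] * N + [:1, -1:] * g"
      using g by (simp add: algebra_simps)
    have "(\<Sum>q\<leftarrow>q # qs. q\<^sup>2) = ([:b:]\<^sup>2 + [:a:]) * N\<^sup>2 + 2 * [:1, -1:] * N * ([:b:] * g + h)
        + [:1, -1:]\<^sup>2 * (g\<^sup>2 + S)"
      by (simp only: list.map sum_list.Cons IH) (subst q, algebra)
    moreover have "[:b:]\<^sup>2 + [:a:] = [:b\<^sup>2 + a:]"
      by (simp add: power2_eq_square)
    moreover have "degree ([:b:] * g + h) \<le> n"
      using deg_g IH by (intro degree_add_le) auto
    moreover have "\<forall>x. poly (g\<^sup>2 + S) x \<ge> 0"
      using IH by simp
    ultimately show ?case
      by metis
  qed
  then show thesis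
    using that by blast
qed

text \<open>
  The alternation argument: comparing a certificate with the extremal one yields a polynomial \<open>l\<close>
  that would have to alternate in sign more often than its degree allows.
\<close>
lemma optimality:
  assumes n: "n \<ge> 1"
    and mem: "f_obj - [:v:] \<in> trunc_quadratic_module (Suc n) p_con"
  shows "v \<le> - (err_root n)\<^sup>2"
proof -
  define t w where "t = [:1, -1 :: real:]" and "w = [:1, 1 :: real:]"
  define N M c where "N = ext_N n" and "M = ext_M n" and "c = err_root n"
  have t_nz: "t \<noteq> 0" and t1: "poly t 1 = 0"
    by (simp_all add: t_def)
  have c: "c > 0" and N1: "poly N 1 = c"
    using err_root_pos[OF n] by (simp_all add: c_def N_def poly_ext_N_1)
  have ext: "t + [:c\<^sup>2:] = N\<^sup>2 + M\<^sup>2 * (t ^ 3 * w)"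
    using ext_decomposition[OF n]
    by (simp only: t_def w_def N_def M_def c_def f_obj_def p_con_def)
  obtain qs s where dec: "t - [:v:] = (\<Sum>q\<leftarrow>qs. q\<^sup>2) + s * (t ^ 3 * w)"
    and s: "s \<in> sos_polys" and deg: "degree (\<Sum>q\<leftarrow>qs. q\<^sup>2) \<le> 2 * Suc n"
    using mem unfolding trunc_quadratic_module_def sos_polys_def f_obj_def p_con_def t_def w_def
    by auto
  have s_nonneg: "poly s x \<ge> 0" for x
  proof -
    obtain us where "s = (\<Sum>q\<leftarrow>us. q\<^sup>2)"
      using s by (auto simp: sos_polys_def)
    moreover have "poly (\<Sum>q\<leftarrow>us. q\<^sup>2) x \<ge> 0"
      by (induction us) auto
    ultimately show ?thesis by simp
  qed
  have N_deg: "degree N \<le> Suc n"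
    unfolding N_def by (rule degree_ext_N)
  obtain a h S where split: "(\<Sum>q\<leftarrow>qs. q\<^sup>2) = [:a:] * N\<^sup>2 + 2 * t * N * h + t\<^sup>2 * S"
    and h: "degree h \<le> n" and S: "\<And>x. poly S x \<ge> 0"
    using sos_split[of N n qs] c N1 N_deg sos_degree_bound[OF deg] unfolding t_def by auto
  have "poly (t - [:v:]) 1 = a * c\<^sup>2"
    unfolding dec split by (simp add: t1 N1)
  then have v: "v = - (a * c\<^sup>2)"
    by (simp add: t1)
  have "a \<ge> 1"
  proof (rule ccontr)
    assume "\<not> a \<ge> 1"
    then have a: "1 - a > 0"
      by simp
    have "poly (N - [:c:]) 1 = 0"
      by (simp add: N1)
    then obtain R where "N - [:c:] = t * R"
      unfolding t_def by (rule root_1_factor)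
    then have N_split: "N = [:c:] + t * R"
      by (simp add: algebra_simps)
    define A where "A = [:a:]"
    define k where "k = h - (1 - A) * R"
    define Y where "Y = S + (1 - A) * R\<^sup>2 + t * w * (s - M\<^sup>2)"
    have c2: "[:c\<^sup>2:] = [:c:]\<^sup>2"
      by (simp add: power2_eq_square)
    have mv: "- [:v:] = A * [:c:]\<^sup>2"
      by (simp add: v A_def power2_eq_square)
    have dec': "t + A * [:c:]\<^sup>2 = A * N\<^sup>2 + 2 * t * N * h + t\<^sup>2 * S + s * (t ^ 3 * w)"
      using dec unfolding split A_def[symmetric] mv[symmetric]
      by (simp only: diff_conv_add_uminus)
    \<comment> \<open>Replacing \<open>a N^2\<close> by means of the extremal certificate and dividing by \<open>t\<close> leaves the constant
      \<open>1 - a\<close> on the left side of the given one. With \<open>N = c + t R\<close>, the extremal certificate also gives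
      \<open>1 = 2 N R - t R^2 + t^2 (2 - t) M^2\<close>, so that after the substitution of this for 1 every term
      carries a factor \<open>N\<close> or \<open>t\<close>.\<close>
    have "t * (2 * N * k + t * Y) = 0"
      unfolding k_def Y_def using dec' ext[unfolded c2] N_split by algebra
    then have kY: "2 * N * k + t * Y = 0"
      using t_nz by simp
    have "poly (2 * N * k + t * Y) 1 = 0"
      unfolding kY by simp
    then have "poly k 1 = 0"
      using c by (simp add: t1 N1)
    then obtain l where l: "k = t * l"
      unfolding t_def by (rule root_1_factor)
    have "t * (2 * N * l + Y) = 0"
      using kY unfolding l by (simp add: algebra_simps)
    then have lY: "2 * N * l + Y = 0"
      using t_nz by simp
    have R_deg: "degree R \<le> n"
    proof -
      have "degree (N - [:c:]) \<le> Suc n"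
        using N_deg by (intro degree_diff_le) auto
      then show ?thesis
        using degree_cofactor[of R] unfolding N_split t_def by simp
    qed
    have "degree k \<le> n"
    proof -
      have "(1 - A) * R = smult (1 - a) R"
        by (simp add: A_def one_pCons)
      then show ?thesis
        unfolding k_def using h R_deg by (simp add: degree_diff_le)
    qed
    then have l_deg: "degree l < n"
      using n degree_cofactor[of l] unfolding l t_def by linarith
    obtain x where x: "x 0 = (1::real)" "\<And>i j. i < j \<Longrightarrow> j \<le> n \<Longrightarrow> x j < x i"
        "\<And>k. k \<le> n \<Longrightarrow> (x k)\<^sup>2 \<le> 1"
        "\<And>k. k \<le> n \<Longrightarrow> (-1) ^ k * poly N (x k) > 0"
        "\<And>k. k \<le> n \<Longrightarrow> (1 - (x k)\<^sup>2) * (poly M (x k))\<^sup>2 = 0"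
      using alternation_nodes[OF n] unfolding N_def M_def by blast
    \<comment> \<open>At the nodes the only term of unfavourable sign, the one with \<open>M^2\<close>, disappears.\<close>
    have node_eq: "2 * poly N (x k) * poly l (x k)
        = - (poly S (x k) + (1 - a) * (poly R (x k))\<^sup>2 + (1 - (x k)\<^sup>2) * poly s (x k))"
      if "k \<le> n" for k
    proof -
      have "poly (2 * N * l + Y) (x k) = 0"
        unfolding lY by simp
      moreover have "poly Y (x k) = poly S (x k) + (1 - a) * (poly R (x k))\<^sup>2
          + (1 - (x k)\<^sup>2) * poly s (x k) - (1 - (x k)\<^sup>2) * (poly M (x k))\<^sup>2"
        unfolding Y_def A_def t_def w_def by (simp add: power2_eq_square algebra_simps)
      ultimately show ?thesis
        using x(5)[OF that] by simp
    qed
    have alt: "(-1) ^ k * poly l (x k) \<le> 0" if "k \<le> n" for k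
    proof -
      have "poly S (x k) + (1 - a) * (poly R (x k))\<^sup>2 + (1 - (x k)\<^sup>2) * poly s (x k) \<ge> 0"
        using S s_nonneg a x(3)[OF that] by simp
      then have "((-1) ^ k * poly N (x k)) * ((-1) ^ k * poly l (x k)) \<le> 0"
        using node_eq[OF that] by (cases "even k") auto
      then show ?thesis
        using x(4)[OF that] by (metis mult_pos_pos not_le)
    qed
    have "poly l (x 0) = 0"
      using alternation_zero[OF x(2) l_deg alt] by simp
    then have "poly S 1 + (1 - a) * (poly R 1)\<^sup>2 = 0"
      using node_eq[of 0] x(1) by simp
    then have "poly R 1 = 0"
      using S[of 1] a by (simp add: add_nonneg_eq_0_iff)
    \<comment> \<open>But \<open>R(1)\<close> is minus the slope of \<open>N\<close> at 1, and \<open>N^2\<close> has slope \<open>-1\<close> there.\<close>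
    have "t * (R * (N + [:c:]) + M\<^sup>2 * (t\<^sup>2 * w) - 1) = 0"
      using ext[unfolded c2] N_split by algebra
    then have "R * (N + [:c:]) + M\<^sup>2 * (t\<^sup>2 * w) - 1 = 0"
      using t_nz by simp
    then have "poly (R * (N + [:c:]) + M\<^sup>2 * (t\<^sup>2 * w) - 1) 1 = 0"
      by simp
    then show False
      using \<open>poly R 1 = 0\<close> by (simp add: t1)
  qed
  then have "c\<^sup>2 \<le> a * c\<^sup>2"
    using mult_right_mono[of 1 a "c\<^sup>2"] by simp
  then show ?thesis
    by (simp add: v c_def)
qed

section \<open>The relaxation error\<close>

lemma sos_bound_eq:
  assumes "n \<ge> 1"
  shows "sos_bound (Suc n) f_obj p_con = ereal (- (err_root n)\<^sup>2)"
  unfolding sos_bound_def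
proof (rule antisym)
  show "(SUP v\<in>{v. f_obj - [:v:] \<in> trunc_quadratic_module (Suc n) p_con}. ereal v)
      \<le> ereal (- (err_root n)\<^sup>2)"
    using optimality[OF assms] by (intro SUP_least) auto
  show "ereal (- (err_root n)\<^sup>2)
      \<le> (SUP v\<in>{v. f_obj - [:v:] \<in> trunc_quadratic_module (Suc n) p_con}. ereal v)"
    using ext_feasible[OF assms] by (intro SUP_upper) auto
qed

lemma feasible_set_p_con: "feasible_set p_con = {-1..1}"
proof -
  have "0 \<le> poly p_con x \<longleftrightarrow> -1 \<le> x \<and> x \<le> 1" for x
  proof -
    have "poly p_con x = (1 - x)\<^sup>2 * ((1 - x) * (1 + x))"
      by (simp add: p_con_def power2_eq_square power3_eq_cube algebra_simps)
    then show ?thesis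
      by (cases "x = 1") (auto simp: zero_le_mult_iff)
  qed
  then show ?thesis
    unfolding feasible_set_def set_eq_iff mem_Collect_eq atLeastAtMost_iff by blast
qed

lemma opt_value_eq_0: "opt_value f_obj p_con = 0"
  unfolding opt_value_def feasible_set_p_con
proof (rule antisym)
  show "(INF x\<in>{-1..1}. ereal (poly f_obj x)) \<le> 0"
    by (rule INF_lower2[of 1]) (auto simp: f_obj_def)
  show "0 \<le> (INF x\<in>{-1..1}. ereal (poly f_obj x))"
    by (intro INF_greatest) (auto simp: f_obj_def)
qed

theorem theorem2:
  "feasible_set p_con = {-1..1} \<and>
   (\<exists>x. is_arg_min (poly f_obj) (\<lambda>x. x \<in> feasible_set p_con) x \<and> poly f_obj x = 0) \<and>
   opt_value f_obj p_con = 0 \<and>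
   (\<forall>r::nat. r \<ge> 2 \<longrightarrow>
      sos_error r f_obj p_con = ereal (1 / (2 * real r * (real r - 1))))"
proof (intro conjI allI impI)
  show "feasible_set p_con = {-1..1}"
    by (rule feasible_set_p_con)
  show "opt_value f_obj p_con = 0"
    by (rule opt_value_eq_0)
  show "\<exists>x. is_arg_min (poly f_obj) (\<lambda>x. x \<in> feasible_set p_con) x \<and> poly f_obj x = 0"
    by (rule exI[of _ 1]) (auto simp: is_arg_min_def feasible_set_p_con f_obj_def)
  fix r :: nat assume "r \<ge> 2"
  then obtain n where r: "r = Suc n" and n: "n \<ge> 1"
    by (cases r) auto
  show "sos_error r f_obj p_con = ereal (1 / (2 * real r * (real r - 1)))"
    unfolding sos_error_def opt_value_eq_0 r sos_bound_eq[OF n]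
    by (simp add: err_root_sq zero_ereal_def mult_ac add.commute)
qed

end
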